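(* Let $G$ be a countably infinite group that is not locally finite. Let $\mathcal{C}$ be the class of all actions by isometries of groups isomorphic to subgroups of $G$ on all separable metric spaces. Then $\mathcal{C}$ does not admit a universal action.
   Context: A group is locally finite if each of its finitely generated subgroups is finite. Given a class $\mathcal{C}$ of actions of countable groups on separable metric spaces by isometries, an action $\alpha:F\curvearrowright X$ in $\mathcal{C}$ is called a universal action from $\mathcal{C}$ if for every action $\beta:H\curvearrowright Y$ in $\mathcal{C}$ there are a subgroup $H'\leq F$, an isomorphism $\phi:H\to H'$ and an isometric embedding $\psi:Y\to X$ such that $\psi(h\cdot y)=\phi(h)\cdot\psi(y)$ for all $h\in H$, $y\in Y$. *)

theory Defs
  imports "HOL-Analysis.Analysis" "HOL-Algebra.Algebra"
begin

definition finitely_generated_subgroup :: "'a set \<Rightarrow> ('a, 'm) monoid_scheme \<Rightarrow> bool" where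
  "finitely_generated_subgroup K G \<longleftrightarrow>
     subgroup K G \<and> (\<exists>S. finite S \<and> S \<subseteq> carrier G \<and> K = generate G S)"

definition locally_finite_group :: "('a, 'm) monoid_scheme \<Rightarrow> bool" where
  "locally_finite_group G \<longleftrightarrow> (\<forall>K. finitely_generated_subgroup K G \<longrightarrow> finite K)"

record ('g, 'x) metric_action =
  acting_group :: "'g monoid"
  action_space :: "'x metric"
  action :: "'g \<Rightarrow> 'x \<Rightarrow> 'x"

definition isometric_action :: "('g, 'x) metric_action \<Rightarrow> bool" where
  "isometric_action \<beta> \<longleftrightarrow>
     group_action (acting_group \<beta>) (mspace (action_space \<beta>)) (action \<beta>) \<and>
     (\<forall>h \<in> carrier (acting_group \<beta>).
        \<forall>x \<in> mspace (action_space \<beta>). \<forall>y \<in> mspace (action_space \<beta>).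
          mdist (action_space \<beta>) (action \<beta> h x) (action \<beta> h y) = mdist (action_space \<beta>) x y)"

text \<open>The class of the theorem: all isometric actions, on separable metric spaces, of groups
  isomorphic to subgroups of \<open>G\<close>.  The element types \<open>'g\<close> and \<open>'x\<close> are arbitrary.\<close>

definition subgroup_actions :: "('a, 'm) monoid_scheme \<Rightarrow> ('g, 'x) metric_action set" where
  "subgroup_actions G =
     {\<beta>. isometric_action \<beta> \<and>
         separable_space (mtopology_of (action_space \<beta>)) \<and>
         (\<exists>K. subgroup K G \<and> acting_group \<beta> \<cong> G\<lparr>carrier := K\<rparr>)}"

definition action_embeds :: "('h, 'y) metric_action \<Rightarrow> ('f, 'x) metric_action \<Rightarrow> bool" where
  "action_embeds \<beta> \<alpha> \<longleftrightarrow>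
     (\<exists>H' \<phi> \<psi>. subgroup H' (acting_group \<alpha>) \<and>
        \<phi> \<in> iso (acting_group \<beta>) ((acting_group \<alpha>)\<lparr>carrier := H'\<rparr>) \<and>
        \<psi> \<in> mspace (action_space \<beta>) \<rightarrow> mspace (action_space \<alpha>) \<and>
        (\<forall>x \<in> mspace (action_space \<beta>). \<forall>y \<in> mspace (action_space \<beta>).
           mdist (action_space \<alpha>) (\<psi> x) (\<psi> y) = mdist (action_space \<beta>) x y) \<and>
        (\<forall>h \<in> carrier (acting_group \<beta>). \<forall>y \<in> mspace (action_space \<beta>).
           \<psi> (action \<beta> h y) = action \<alpha> (\<phi> h) (\<psi> y)))"

text \<open>A formula cannot quantify over types, so an action is tested against members of the class
  with group elements in one type and points in another; the two types are part of the type of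
  \<open>C\<close>.  That \<open>\<alpha>\<close> itself belongs to the class is required separately, since its types may
  differ from those of \<open>C\<close>.\<close>

definition universal_action :: "('h, 'y) metric_action set \<Rightarrow> ('f, 'x) metric_action \<Rightarrow> bool" where
  "universal_action C \<alpha> \<longleftrightarrow> (\<forall>\<beta> \<in> C. action_embeds \<beta> \<alpha>)"

text \<open>For a group \<open>G\<close> on the type \<open>'a\<close>, testing against actions of groups on \<open>'a\<close> on
  separable spaces with points in \<^typ>\<open>nat \<Rightarrow> real\<close> (with arbitrary metrics) suffices: every
  member of the class, over any types, has an isomorphic copy of that kind.  This is the lemma
  \<open>universal_action_any_types\<close> below.\<close>

lemma separable_metric_inj:
  fixes m :: "'y metric"
  assumes "separable_space (mtopology_of m)"
  shows "\<exists>e :: 'y \<Rightarrow> nat \<Rightarrow> real. inj_on e (mspace m)"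
proof -
  obtain D where D: "countable D" "D \<subseteq> mspace m" "mtopology_of m closure_of D = mspace m"
    using assms by (auto simp: separable_space_def)
  interpret Metric_space "mspace m" "mdist m" by simp
  let ?e = "\<lambda>y n. mdist m y (from_nat_into D n)"
  have "inj_on ?e (mspace m)"
  proof (rule inj_onI, rule ccontr)
    fix x y assume xy: "x \<in> mspace m" "y \<in> mspace m" "?e x = ?e y" "x \<noteq> y"
    then have pos: "mdist m x y / 2 > 0" by simp
    have "x \<in> mtopology_of m closure_of D" using D xy by simp
    then have "\<forall>r>0. \<exists>z\<in>D. z \<in> mspace m \<and> mdist m x z < r"
      by (auto simp: mtopology_of_def metric_closure_of)
    then obtain z where z: "z \<in> D" "z \<in> mspace m" "mdist m x z < mdist m x y / 2"
      using pos by blast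
    have "mdist m x z = mdist m y z"
      using fun_cong[OF xy(3), of "to_nat_on D z"] D(1) z(1) by simp
    then show False
      using z xy triangle'[of x z y] by simp
  qed
  then show ?thesis by blast
qed

lemma BijGroup_transport_hom:
  assumes "inj_on e Y"
  shows "(\<lambda>f. \<lambda>p\<in>e ` Y. e (f (inv_into Y e p))) \<in> hom (BijGroup Y) (BijGroup (e ` Y))"
proof -
  let ?c = "\<lambda>f. \<lambda>p\<in>e ` Y. e (f (inv_into Y e p))"
  have c: "?c f \<in> Bij (e ` Y)" if "f \<in> Bij Y" for f
  proof -
    have f: "bij_betw f Y Y" using that by (simp add: Bij_def)
    have e: "bij_betw e Y (e ` Y)" using assms by (simp add: bij_betw_def)
    have "bij_betw (e \<circ> (f \<circ> inv_into Y e)) (e ` Y) (e ` Y)"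
      using bij_betw_trans[OF bij_betw_trans[OF bij_betw_inv_into[OF e] f] e] by (simp add: comp_assoc)
    then have "bij_betw (?c f) (e ` Y) (e ` Y)"
      by (rule bij_betw_cong[THEN iffD1, rotated]) auto
    then show ?thesis by (simp add: Bij_def)
  qed
  show ?thesis
  proof (rule homI)
    fix f assume "f \<in> carrier (BijGroup Y)"
    then show "?c f \<in> carrier (BijGroup (e ` Y))" using c by (simp add: BijGroup_def)
  next
    fix f g assume "f \<in> carrier (BijGroup Y)" "g \<in> carrier (BijGroup Y)"
    then have fg: "f \<in> Bij Y" "g \<in> Bij Y" by (simp_all add: BijGroup_def)
    then have "g y \<in> Y" if "y \<in> Y" for y
      using that Bij_imp_funcset by blast
    then have "?c (compose Y f g) = compose (e ` Y) (?c f) (?c g)"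
      using assms by (auto simp: compose_def fun_eq_iff)
    then show "?c (f \<otimes>\<^bsub>BijGroup Y\<^esub> g) = ?c f \<otimes>\<^bsub>BijGroup (e ` Y)\<^esub> ?c g"
      using fg c by (simp add: BijGroup_def)
  qed
qed

lemma universal_action_any_types:
  fixes G :: "('a, 'm) monoid_scheme" and \<alpha> :: "('f, 'x) metric_action"
  assumes G: "group G"
    and univ: "universal_action (subgroup_actions G :: ('a, nat \<Rightarrow> real) metric_action set) \<alpha>"
  shows "universal_action (subgroup_actions G :: ('h, 'y) metric_action set) \<alpha>"
  unfolding universal_action_def
proof
  fix \<beta> :: "('h, 'y) metric_action"
  assume "\<beta> \<in> subgroup_actions G"
  then obtain K \<theta> where iso: "isometric_action \<beta>"
    and sep: "separable_space (mtopology_of (action_space \<beta>))"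
    and K: "subgroup K G" and \<theta>: "\<theta> \<in> iso (acting_group \<beta>) (G\<lparr>carrier := K\<rparr>)"
    by (auto simp: subgroup_actions_def is_iso_def)
  define H where "H = acting_group \<beta>"
  define Y where "Y = mspace (action_space \<beta>)"
  define d where "d = mdist (action_space \<beta>)"
  define H' :: "'a monoid" where "H' = \<lparr>carrier = K, mult = mult G, one = one G\<rparr>"
  obtain e :: "'y \<Rightarrow> nat \<Rightarrow> real" where e: "inj_on e Y"
    using separable_metric_inj[OF sep] unfolding Y_def by blast
  define ei where "ei = inv_into Y e"
  have ei [simp]: "ei (e y) = y" if "y \<in> Y" for y
    using that e by (simp add: ei_def)
  interpret act: group_action H Y "action \<beta>"
    using iso by (simp add: isometric_action_def H_def Y_def)
  have gH: "group H" using act.group_hom by (simp add: group_hom_def)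
  have isom: "d (action \<beta> h x) (action \<beta> h y) = d x y" if "h \<in> carrier H" "x \<in> Y" "y \<in> Y" for h x y
    using iso that by (simp add: isometric_action_def H_def Y_def d_def)
  have "group (G\<lparr>carrier := K\<rparr>)" using K G by (simp add: subgroup.subgroup_is_group)
  then have gH': "group H'"
    unfolding H'_def group_def monoid_def group_axioms_def Units_def by simp
  have \<theta>': "\<theta> \<in> iso H H'"
    using \<theta> unfolding iso_def hom_def H'_def H_def by simp
  define \<tau> where "\<tau> = inv_into (carrier H) \<theta>"
  have \<tau>: "\<tau> \<in> iso H' H"
    unfolding \<tau>_def by (rule group.iso_set_sym[OF gH \<theta>'])
  have \<tau>\<theta>: "\<tau> (\<theta> h) = h" if "h \<in> carrier H" for h
    using that \<theta>' by (simp add: \<tau>_def iso_def bij_betw_def)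
  have \<tau>c: "\<tau> g \<in> carrier H" if "g \<in> carrier H'" for g
    using that \<tau> by (auto simp: iso_def hom_def)
  interpret mY: Metric_space Y d by (simp add: Y_def d_def)
  define d' where "d' = (\<lambda>p q. d (ei p) (ei q))"
  interpret m': Metric_space "e ` Y" d'
    by unfold_locales (auto simp: d'_def mY.commute mY.triangle)
  define act' where "act' = (\<lambda>g. \<lambda>p\<in>e ` Y. e (action \<beta> (\<tau> g) (ei p)))"
  define \<beta>' where "\<beta>' = \<lparr>acting_group = H', action_space = metric (e ` Y, d'), action = act'\<rparr>"
  have \<beta>' [simp]: "acting_group \<beta>' = H'" "mspace (action_space \<beta>') = e ` Y"
    "mdist (action_space \<beta>') = d'" "action \<beta>' = act'"
    "mtopology_of (action_space \<beta>') = m'.mtopology"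
    by (simp_all add: \<beta>'_def)
  have "(\<lambda>f. \<lambda>p\<in>e ` Y. e (f (ei p))) \<circ> (action \<beta> \<circ> \<tau>) \<in> hom H' (BijGroup (e ` Y))"
  proof (rule hom_compose)
    show "(\<lambda>f. \<lambda>p\<in>e ` Y. e (f (ei p))) \<in> hom (BijGroup Y) (BijGroup (e ` Y))"
      unfolding ei_def by (rule BijGroup_transport_hom[OF e])
    show "action \<beta> \<circ> \<tau> \<in> hom H' (BijGroup Y)"
    proof (rule hom_compose)
      show "\<tau> \<in> hom H' H" using \<tau> by (simp add: iso_def)
      show "action \<beta> \<in> hom H (BijGroup Y)" 
        using act.group_hom by (simp add: group_hom_def group_hom_axioms_def)
    qed
  qed
  then have "act' \<in> hom H' (BijGroup (e ` Y))" by (simp add: act'_def comp_def)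
  then have ga: "group_action H' (e ` Y) act'"
    using gH' by (simp add: group_action_def group_hom_def group_hom_axioms_def group_BijGroup)
  have "isometric_action \<beta>'"
    unfolding isometric_action_def
    using ga by (auto simp: act'_def d'_def isom \<tau>c act.element_image[OF _ _ refl])
  moreover have "separable_space m'.mtopology"
  proof -
    interpret M12: Metric_space12 Y d "e ` Y" d' by unfold_locales
    have "homeomorphic_map mY.mtopology m'.mtopology e"
      by (rule M12.isometry_imp_homeomorphic_map) (auto simp: d'_def)
    moreover have "separable_space mY.mtopology"
      using sep by (simp add: mtopology_of_def Y_def d_def)
    ultimately show ?thesis
      using homeomorphic_separable_space homeomorphic_map_imp_homeomorphic_space by blast
  qed
  moreover have "H' \<cong> G\<lparr>carrier := K\<rparr>"
    unfolding is_iso_def iso_def hom_def H'_def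
    by (auto intro!: exI[of _ "\<lambda>x. x"] simp: bij_betw_def)
  ultimately have "\<beta>' \<in> subgroup_actions G"
    using K by (auto simp: subgroup_actions_def)
  then have "action_embeds \<beta>' \<alpha>"
    using univ by (simp add: universal_action_def)
  then obtain L \<phi> \<psi> where L: "subgroup L (acting_group \<alpha>)"
    and \<phi>: "\<phi> \<in> iso H' ((acting_group \<alpha>)\<lparr>carrier := L\<rparr>)"
    and \<psi>: "\<psi> \<in> e ` Y \<rightarrow> mspace (action_space \<alpha>)"
    and \<psi>d: "\<And>x y. \<lbrakk>x \<in> Y; y \<in> Y\<rbrakk> \<Longrightarrow> mdist (action_space \<alpha>) (\<psi> (e x)) (\<psi> (e y)) = d' (e x) (e y)"
    and \<psi>a: "\<And>h y. \<lbrakk>h \<in> carrier H'; y \<in> Y\<rbrakk> \<Longrightarrow> \<psi> (act' h (e y)) = action \<alpha> (\<phi> h) (\<psi> (e y))"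
    unfolding action_embeds_def by auto
  show "action_embeds \<beta> \<alpha>"
    unfolding action_embeds_def H_def[symmetric] Y_def[symmetric] d_def[symmetric]
  proof (intro exI conjI ballI)
    show "subgroup L (acting_group \<alpha>)" by (rule L)
    show "\<phi> \<circ> \<theta> \<in> iso H ((acting_group \<alpha>)\<lparr>carrier := L\<rparr>)"
      using \<theta>' \<phi> by (rule iso_set_trans)
    show "\<psi> \<circ> e \<in> Y \<rightarrow> mspace (action_space \<alpha>)" using \<psi> by auto
  next
    fix x y assume "x \<in> Y" "y \<in> Y"
    then show "mdist (action_space \<alpha>) ((\<psi> \<circ> e) x) ((\<psi> \<circ> e) y) = d x y"
      using \<psi>d by (simp add: d'_def)
  next
    fix h y assume h: "h \<in> carrier H" and y: "y \<in> Y"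
    have "\<theta> h \<in> carrier H'" using h \<theta>' by (auto simp: iso_def hom_def)
    from \<psi>a[OF this y] show "(\<psi> \<circ> e) (action \<beta> h y) = action \<alpha> ((\<phi> \<circ> \<theta>) h) ((\<psi> \<circ> e) y)"
      using h y by (simp add: act'_def \<tau>\<theta>)
  qed
qed

end

theory Submission
  imports Defs
begin

text \<open>
  The reason is a clash between separability and the number of isometric actions of one infinite
  group \<open>K\<close>.  Since \<open>G\<close> is not locally finite, \<open>K\<close> can be taken to be an infinite finitely
  generated subgroup.  For every subset \<open>A\<close> of \<open>K\<close> there is an isometric action of \<open>K\<close> on a countable
  metric space with two base points \<open>p\<close>, \<open>q\<close> such that the distance from \<open>p\<close> to \<open>h q\<close> is \<open>2\<close> for
  \<open>h \<in> A\<close> and \<open>1\<close> otherwise (\<open>two_copy_action\<close>): distances between \<open>1\<close> and \<open>2\<close> satisfy the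
  triangle inequality whatever they are, so \<open>A\<close> is unconstrained.

  Suppose that all these actions embed into one action of a group \<open>F\<close> on a space \<open>M\<close>, where \<open>F\<close> is
  countable and \<open>M\<close> is separable.  An embedding supplies a homomorphism \<open>\<phi>\<close> from \<open>K\<close> to \<open>F\<close> and
  points \<open>p\<close>, \<open>q\<close> of \<open>M\<close> for which \<open>h \<mapsto> d p (\<phi> h q)\<close> is the function \<open>1 +\<close> indicator of \<open>A\<close>.
  There are only countably many \<open>\<phi>\<close>, because \<open>K\<close> is finitely generated and \<open>F\<close> is countable
  (\<open>countable_hom_generate\<close>).  Moving \<open>p\<close> and \<open>q\<close> by less than \<open>1/4\<close> each, into a countable dense
  set, moves that function by less than \<open>1/2\<close> uniformly in \<open>h\<close>, because \<open>F\<close> acts by isometries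
  (\<open>isometric_action_dist_diff\<close>).  Hence every \<open>1 +\<close> indicator of \<open>A\<close> would be uniformly within less
  than \<open>1/2\<close> of a member of one countable family of functions, and a diagonal choice of \<open>A\<close>
  (\<open>ex_subset_far_from_countable\<close>) contradicts this.

  Finite generation is what makes the homomorphisms countable in number: an infinitely generated
  group may have uncountably many homomorphisms into a countable group.
\<close>

section \<open>Homomorphisms from a finitely generated group\<close>

lemma hom_eqI_generate:
  assumes G: "group G" and F: "group F" and S: "S \<subseteq> carrier G"
    and \<phi>: "\<phi> \<in> hom (G\<lparr>carrier := generate G S\<rparr>) F"
    and \<psi>: "\<psi> \<in> hom (G\<lparr>carrier := generate G S\<rparr>) F"
    and eq: "\<And>s. s \<in> S \<Longrightarrow> \<phi> s = \<psi> s"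
    and x: "x \<in> generate G S"
  shows "\<phi> x = \<psi> x"
proof -
  let ?K = "G\<lparr>carrier := generate G S\<rparr>"
  have sub: "subgroup (generate G S) G"
    using G S by (rule group.generate_is_subgroup)
  then have K: "group ?K"
    using G by (rule subgroup.subgroup_is_group)
  interpret p: group_hom ?K F \<phi> using K F \<phi> by (simp add: group_hom_def group_hom_axioms_def)
  interpret q: group_hom ?K F \<psi> using K F \<psi> by (simp add: group_hom_def group_hom_axioms_def)
  from x show ?thesis
  proof (induction rule: generate.induct)
    case one
    show ?case using p.hom_one q.hom_one by simp
  next
    case (incl h)
    then show ?case by (rule eq)
  next
    case (inv h)
    then have h: "h \<in> generate G S" by (rule generate.incl)
    then have "inv\<^bsub>?K\<^esub> h = inv\<^bsub>G\<^esub> h"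
      using group.m_inv_consistent[OF G sub] by simp
    then show ?case using p.hom_inv[of h] q.hom_inv[of h] h eq[OF inv] by simp
  next
    case (eng h1 h2)
    then show ?case using p.hom_mult[of h1 h2] q.hom_mult[of h1 h2] by simp
  qed
qed

text \<open>A homomorphism is determined by its values on the finite set \<open>S\<close>, and a countable group leaves
  countably many choices for these.  The homomorphisms are restricted to the generated subgroup
  because their arbitrary values elsewhere could make the set of them uncountable.\<close>

lemma countable_hom_generate:
  assumes G: "group G" and F: "group F" and S: "finite S" "S \<subseteq> carrier G"
    and cF: "countable (carrier F)"
  shows "countable ((\<lambda>\<phi>. restrict \<phi> (generate G S)) ` hom (G\<lparr>carrier := generate G S\<rparr>) F)"
proof -
  let ?H = "hom (G\<lparr>carrier := generate G S\<rparr>) F"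
  let ?R = "(\<lambda>\<phi>. restrict \<phi> (generate G S)) ` ?H"
  have incl: "S \<subseteq> generate G S" by (auto intro: generate.incl)
  have "countable (PiE S (\<lambda>_. carrier F))"
    using S cF by (intro countable_PiE) auto
  moreover have "(\<lambda>f. restrict f S) ` ?R \<subseteq> PiE S (\<lambda>_. carrier F)"
    using incl by (auto simp: hom_def Pi_iff)
  ultimately have "countable ((\<lambda>f. restrict f S) ` ?R)"
    by (rule countable_subset[rotated])
  moreover have "inj_on (\<lambda>f. restrict f S) ?R"
  proof (rule inj_onI, clarify)
    fix \<phi> \<psi> assume hom: "\<phi> \<in> ?H" "\<psi> \<in> ?H"
      and eq: "restrict (restrict \<phi> (generate G S)) S = restrict (restrict \<psi> (generate G S)) S"
    have "\<phi> s = \<psi> s" if "s \<in> S" for s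
      using fun_cong[OF eq, of s] that incl by auto
    then have "\<phi> x = \<psi> x" if "x \<in> generate G S" for x
      using hom_eqI_generate[OF G F S(2) hom] that by blast
    then show "restrict \<phi> (generate G S) = restrict \<psi> (generate G S)"
      by (auto simp: restrict_def)
  qed
  ultimately show "countable ?R"
    using countable_image_inj_on by blast
qed

section \<open>Diagonalisation\<close>

text \<open>Cantor's argument with room to spare: each \<open>f \<in> R\<close> is assigned a position \<open>h\<close> of its own, and
  \<open>A\<close> prescribes at \<open>h\<close> the one of the values \<open>1\<close>, \<open>2\<close> that lies on the other side of \<open>3/2\<close> from
  \<open>f h\<close>.\<close>

lemma ex_subset_far_from_countable:
  fixes R :: "('a \<Rightarrow> real) set"
  assumes H: "countable H" "infinite H" and R: "countable R"
  shows "\<exists>A. \<forall>f\<in>R. \<exists>h\<in>H. 1/2 \<le> \<bar>f h - (if h \<in> A then 2 else 1)\<bar>"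
proof (intro exI ballI)
  \<comment> \<open>The function assigned to the position \<open>h\<close>; the set below is the value of \<open>A\<close>.\<close>
  let ?c = "\<lambda>h. from_nat_into R (to_nat_on H h)"
  fix f assume f: "f \<in> R"
  obtain n where n: "from_nat_into R n = f"
    using from_nat_into_surj[OF R f] by blast
  obtain h where "h \<in> H" "to_nat_on H h = n"
    using bij_betw_imp_surj_on[OF to_nat_on_infinite[OF H]] by (metis UNIV_I imageE)
  with n show "\<exists>h\<in>H. 1/2 \<le> \<bar>f h - (if h \<in> {h. ?c h h < 3/2} then 2 else 1)\<bar>"
    by (intro bexI[of _ h]) auto
qed

section \<open>Isometric actions that encode subsets\<close>

text \<open>The distance is \<open>2\<close> exactly when one point \<open>g\<close> lies in the copy \<open>False\<close>, the other point \<open>h\<close> in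
  the copy \<open>True\<close>, and \<open>g\<^sup>-\<^sup>1 h \<in> A\<close>; the second disjunct makes it symmetric.  Two copies of the
  group are used so that the copies tell the endpoints apart: on a single copy a left-invariant
  symmetric distance of this kind exists only for \<open>A\<close> closed under inverses.\<close>

definition two_copy_dist :: "('a, 'm) monoid_scheme \<Rightarrow> 'a set \<Rightarrow> 'a \<times> bool \<Rightarrow> 'a \<times> bool \<Rightarrow> real" where
  "two_copy_dist H A p q =
     (if p = q then 0
      else if \<not> snd p \<and> snd q \<and> inv\<^bsub>H\<^esub> fst p \<otimes>\<^bsub>H\<^esub> fst q \<in> A \<or>
              \<not> snd q \<and> snd p \<and> inv\<^bsub>H\<^esub> fst q \<otimes>\<^bsub>H\<^esub> fst p \<in> A then 2 else 1)"

definition two_copy_action :: "'a monoid \<Rightarrow> 'a set \<Rightarrow> ('a, 'a \<times> bool) metric_action" where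
  "two_copy_action H A =
     \<lparr>acting_group = H,
      action_space = metric (carrier H \<times> UNIV, two_copy_dist H A),
      action = (\<lambda>g. \<lambda>p\<in>carrier H \<times> UNIV. (g \<otimes>\<^bsub>H\<^esub> fst p, snd p))\<rparr>"

text \<open>Distinct points have distance \<open>1\<close> or \<open>2\<close>, and \<open>2 \<le> 1 + 1\<close>.\<close>

lemma Metric_space_two_copy: "Metric_space M (two_copy_dist H A)"
  by unfold_locales (auto simp: two_copy_dist_def)

lemma two_copy_action_simps [simp]:
  "acting_group (two_copy_action H A) = H"
  "mspace (action_space (two_copy_action H A)) = carrier H \<times> UNIV"
  "mdist (action_space (two_copy_action H A)) = two_copy_dist H A"
  "action (two_copy_action H A) = (\<lambda>g. \<lambda>p\<in>carrier H \<times> UNIV. (g \<otimes>\<^bsub>H\<^esub> fst p, snd p))"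
  using Metric_space_two_copy[of "carrier H \<times> UNIV" H A]
  by (simp_all add: two_copy_action_def Metric_space.mspace_metric Metric_space.mdist_metric)

lemma (in group) two_copy_translation:
  assumes g: "g \<in> carrier G"
  shows "(\<lambda>p\<in>carrier G \<times> (UNIV :: bool set). (g \<otimes> fst p, snd p)) \<in> Bij (carrier G \<times> UNIV)"
proof -
  have "bij_betw (\<lambda>p. (g \<otimes> fst p, snd p)) (carrier G \<times> (UNIV :: bool set)) (carrier G \<times> UNIV)"
    using g by (intro bij_betw_byWitness[where f' = "\<lambda>p. (inv g \<otimes> fst p, snd p)"])
      (auto simp: m_assoc[symmetric])
  then show ?thesis by (simp add: Bij_def)
qed

text \<open>Left translation by \<open>g\<close> preserves the copies and cancels in \<open>(g x)\<^sup>-\<^sup>1 (g y)\<close>.\<close>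

lemma isometric_two_copy_action:
  fixes A :: "'a set" and H :: "'a monoid"
  assumes H: "group H"
  shows "isometric_action (two_copy_action H A)"
proof -
  interpret H: group H by (rule H)
  let ?t = "\<lambda>g. \<lambda>p\<in>carrier H \<times> (UNIV :: bool set). (g \<otimes>\<^bsub>H\<^esub> fst p, snd p)"
  have "?t \<in> hom H (BijGroup (carrier H \<times> UNIV))"
  proof (rule homI)
    show "?t g \<in> carrier (BijGroup (carrier H \<times> UNIV))" if "g \<in> carrier H" for g
      using H.two_copy_translation[OF that] by (simp add: BijGroup_def)
    show "?t (g \<otimes>\<^bsub>H\<^esub> h) = ?t g \<otimes>\<^bsub>BijGroup (carrier H \<times> UNIV)\<^esub> ?t h"
      if "g \<in> carrier H" "h \<in> carrier H" for g h
      using that H.two_copy_translation[OF that(1)] H.two_copy_translation[OF that(2)]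
      by (auto simp: BijGroup_def compose_def fun_eq_iff H.m_assoc)
  qed
  then have "group_action H (carrier H \<times> UNIV) ?t"
    using H by (simp add: group_action_def group_hom_def group_hom_axioms_def group_BijGroup)
  moreover have "inv\<^bsub>H\<^esub> (g \<otimes>\<^bsub>H\<^esub> x) \<otimes>\<^bsub>H\<^esub> (g \<otimes>\<^bsub>H\<^esub> y) = inv\<^bsub>H\<^esub> x \<otimes>\<^bsub>H\<^esub> y"
    if "g \<in> carrier H" "x \<in> carrier H" "y \<in> carrier H" for g x y
  proof -
    have "inv\<^bsub>H\<^esub> g \<otimes>\<^bsub>H\<^esub> (g \<otimes>\<^bsub>H\<^esub> y) = y"
      using that by (simp add: H.m_assoc[symmetric])
    then show ?thesis using that by (simp add: H.inv_mult_group H.m_assoc)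
  qed
  ultimately show ?thesis
    by (auto simp: isometric_action_def two_copy_dist_def)
qed

lemma separable_space_countable_topspace:
  assumes "countable (topspace T)"
  shows "separable_space T"
  unfolding separable_space_def
  by (rule exI[of _ "topspace T"]) (simp add: assms)

lemma two_copy_action_in_subgroup_actions:
  fixes H :: "'a monoid" and G :: "('b, 'm) monoid_scheme"
  assumes "group H" "countable (carrier H)" "subgroup K G" "H \<cong> G\<lparr>carrier := K\<rparr>"
  shows "two_copy_action H A \<in> subgroup_actions G"
  using assms isometric_two_copy_action[OF assms(1)]
  by (auto simp: subgroup_actions_def intro!: separable_space_countable_topspace)

text \<open>All that an embedding needs to retain: the images \<open>p\<close>, \<open>q\<close> of the identity in the two copies
  recover \<open>A\<close> from distances in the target.\<close>

lemma two_copy_action_embeds_orbit: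
  fixes H :: "'a monoid" and \<alpha> :: "('f, 'x) metric_action"
  assumes H: "group H" and F: "group (acting_group \<alpha>)"
    and emb: "action_embeds (two_copy_action H A) \<alpha>"
  obtains \<phi> p q where "\<phi> \<in> hom H (acting_group \<alpha>)"
    "p \<in> mspace (action_space \<alpha>)" "q \<in> mspace (action_space \<alpha>)"
    "\<And>h. h \<in> carrier H \<Longrightarrow>
       mdist (action_space \<alpha>) p (action \<alpha> (\<phi> h) q) = (if h \<in> A then 2 else 1)"
proof -
  interpret H: group H by (rule H)
  let ?d = "mdist (action_space \<alpha>)"
  obtain L \<phi> \<psi> where L: "subgroup L (acting_group \<alpha>)"
    and \<phi>: "\<phi> \<in> iso H ((acting_group \<alpha>)\<lparr>carrier := L\<rparr>)"
    and \<psi>: "\<psi> \<in> carrier H \<times> UNIV \<rightarrow> mspace (action_space \<alpha>)"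
    and dist: "\<And>x y. \<lbrakk>x \<in> carrier H \<times> UNIV; y \<in> carrier H \<times> UNIV\<rbrakk>
                \<Longrightarrow> ?d (\<psi> x) (\<psi> y) = two_copy_dist H A x y"
    and equiv: "\<And>h y. \<lbrakk>h \<in> carrier H; y \<in> carrier H \<times> UNIV\<rbrakk>
                \<Longrightarrow> \<psi> (h \<otimes>\<^bsub>H\<^esub> fst y, snd y) = action \<alpha> (\<phi> h) (\<psi> y)"
    using emb unfolding action_embeds_def by auto
  let ?p = "\<psi> (\<one>\<^bsub>H\<^esub>, False)" and ?q = "\<psi> (\<one>\<^bsub>H\<^esub>, True)"
  have "\<phi> \<in> hom H (acting_group \<alpha>)"
    using \<phi> subgroup.subset[OF L] by (auto simp: iso_def hom_def)
  moreover have "?p \<in> mspace (action_space \<alpha>)" "?q \<in> mspace (action_space \<alpha>)"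
    using \<psi> by auto
  moreover have "?d ?p (action \<alpha> (\<phi> h) ?q) = (if h \<in> A then 2 else 1)" if h: "h \<in> carrier H" for h
  proof -
    have "action \<alpha> (\<phi> h) ?q = \<psi> (h, True)"
      using equiv[of h "(\<one>\<^bsub>H\<^esub>, True)"] h by simp
    then show ?thesis
      using dist[of "(\<one>\<^bsub>H\<^esub>, False)" "(h, True)"] h by (simp add: two_copy_dist_def)
  qed
  ultimately show thesis by (rule that)
qed

section \<open>Stability under moving the base points\<close>

lemma (in Metric_space) dist_diff_le:
  assumes "p \<in> M" "q \<in> M" "z \<in> M" "w \<in> M"
  shows "\<bar>d p q - d z w\<bar> \<le> d p z + d q w"
  using assms triangle[of p z q] triangle[of z w q] triangle[of z p w] triangle[of p q w]
    commute[of p z] commute[of q w] by linarith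

text \<open>The bound does not depend on \<open>g\<close>, so approximating two base points approximates the whole
  function \<open>g \<mapsto> d p (g q)\<close> uniformly.\<close>

lemma isometric_action_dist_diff:
  fixes \<alpha> :: "('f, 'x) metric_action"
  assumes \<alpha>: "isometric_action \<alpha>" and g: "g \<in> carrier (acting_group \<alpha>)"
    and pts: "p \<in> mspace (action_space \<alpha>)" "q \<in> mspace (action_space \<alpha>)"
      "z \<in> mspace (action_space \<alpha>)" "w \<in> mspace (action_space \<alpha>)"
  shows "\<bar>mdist (action_space \<alpha>) p (action \<alpha> g q) - mdist (action_space \<alpha>) z (action \<alpha> g w)\<bar>
    \<le> mdist (action_space \<alpha>) p z + mdist (action_space \<alpha>) q w"
proof -
  interpret Metric_space "mspace (action_space \<alpha>)" "mdist (action_space \<alpha>)" by simp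
  interpret act: group_action "acting_group \<alpha>" "mspace (action_space \<alpha>)" "action \<alpha>"
    using \<alpha> by (simp add: isometric_action_def)
  have "action \<alpha> g q \<in> mspace (action_space \<alpha>)" "action \<alpha> g w \<in> mspace (action_space \<alpha>)"
    using act.element_image[OF g] pts by auto
  moreover have "mdist (action_space \<alpha>) (action \<alpha> g q) (action \<alpha> g w) = mdist (action_space \<alpha>) q w"
    using \<alpha> g pts by (simp add: isometric_action_def)
  ultimately show ?thesis
    using dist_diff_le[of p "action \<alpha> g q" z "action \<alpha> g w"] pts by simp
qed

section \<open>Nonexistence of a universal action\<close>

theorem theorem0p5:
  fixes G :: "('a, 'm) monoid_scheme"
  assumes "group G"
    and "countable (carrier G)"
    and "infinite (carrier G)"
    and "\<not> locally_finite_group G"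
  shows "\<not> (\<exists>\<alpha> :: ('f, 'x) metric_action.
            \<alpha> \<in> subgroup_actions G \<and>
            universal_action (subgroup_actions G :: ('a, nat \<Rightarrow> real) metric_action set) \<alpha>)"
proof
  assume "\<exists>\<alpha> :: ('f, 'x) metric_action. \<alpha> \<in> subgroup_actions G \<and>
            universal_action (subgroup_actions G :: ('a, nat \<Rightarrow> real) metric_action set) \<alpha>"
  then obtain \<alpha> :: "('f, 'x) metric_action" where \<alpha>: "\<alpha> \<in> subgroup_actions G"
    and "universal_action (subgroup_actions G :: ('a, nat \<Rightarrow> real) metric_action set) \<alpha>" by blast
  \<comment> \<open>The test actions below have points in \<^typ>\<open>'a \<times> bool\<close>.\<close>
  then have univ: "universal_action (subgroup_actions G :: ('a, 'a \<times> bool) metric_action set) \<alpha>"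
    using universal_action_any_types[OF assms(1)] by blast
  define F where "F = acting_group \<alpha>"
  define M where "M = mspace (action_space \<alpha>)"
  define d where "d = mdist (action_space \<alpha>)"
  interpret M: Metric_space M d by (simp add: M_def d_def)
  have iso\<alpha>: "isometric_action \<alpha>" and sep: "separable_space M.mtopology"
    using \<alpha> by (auto simp: subgroup_actions_def mtopology_of_def M_def d_def)
  have F: "group F"
    using iso\<alpha> by (simp add: isometric_action_def group_action_def group_hom_def F_def)
  obtain L \<theta> where "subgroup L G" "\<theta> \<in> iso F (G\<lparr>carrier := L\<rparr>)"
    using \<alpha> by (auto simp: subgroup_actions_def is_iso_def F_def)
  then have "inj_on \<theta> (carrier F)" "\<theta> ` carrier F \<subseteq> carrier G"
    using subgroup.subset by (fastforce simp: iso_def bij_betw_def)+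
  then have cF: "countable (carrier F)"
    using assms(2) countable_image_inj_on countable_subset by blast
  obtain D where D: "countable D" "D \<subseteq> M" "M.mtopology closure_of D = M"
    using sep by (auto simp: separable_space_def)
  have dense: "\<exists>z\<in>D. d x z < 1/4" if "x \<in> M" for x
  proof -
    have "\<forall>r>0. \<exists>z\<in>D. z \<in> M \<and> d x z < r"
      using that D(3) by (auto simp: M.metric_closure_of)
    then show ?thesis by (metis zero_less_divide_1_iff zero_less_numeral)
  qed

  obtain S where S: "finite S" "S \<subseteq> carrier G" and inf: "infinite (generate G S)"
    using assms(4) by (auto simp: locally_finite_group_def finitely_generated_subgroup_def)
  define K where "K = generate G S"
  have subK: "subgroup K G"
    unfolding K_def using assms(1) S(2) by (rule group.generate_is_subgroup)
  have cK: "countable K"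
    using subgroup.subset[OF subK] assms(2) countable_subset by blast
  \<comment> \<open>The subgroup as a group of its own, without the possible extra record fields of \<open>G\<close>.\<close>
  define H :: "'a monoid" where "H = \<lparr>carrier = K, mult = mult G, one = one G\<rparr>"
  have cH [simp]: "carrier H = K" by (simp add: H_def)
  have "group (G\<lparr>carrier := K\<rparr>)" using subK assms(1) by (rule subgroup.subgroup_is_group)
  then have H: "group H"
    unfolding H_def group_def monoid_def group_axioms_def Units_def by simp
  have "H \<cong> G\<lparr>carrier := K\<rparr>"
    unfolding is_iso_def iso_def hom_def H_def
    by (auto intro!: exI[of _ "\<lambda>x. x"] simp: bij_betw_def)
  then have in_class: "two_copy_action H A \<in> subgroup_actions G" for A
    using two_copy_action_in_subgroup_actions[OF H _ subK] cK by simp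

  define \<Phi> where "\<Phi> = (\<lambda>\<phi>. restrict \<phi> K) ` hom (G\<lparr>carrier := K\<rparr>) F"
  have "countable \<Phi>"
    unfolding \<Phi>_def K_def using countable_hom_generate[OF assms(1) F S cF] .
  then have "countable ((\<lambda>(\<phi>, z, w) h. d z (action \<alpha> (\<phi> h) w)) ` (\<Phi> \<times> D \<times> D))"
    using D(1) by simp
  \<comment> \<open>\<open>A\<close> is chosen before any embedding is given, against all homomorphisms and all pairs of points
    of the dense set at once.\<close>
  then obtain A where A: "\<And>\<phi> z w. \<lbrakk>\<phi> \<in> \<Phi>; z \<in> D; w \<in> D\<rbrakk> \<Longrightarrow>
      \<exists>h\<in>K. 1/2 \<le> \<bar>d z (action \<alpha> (\<phi> h) w) - (if h \<in> A then 2 else 1)\<bar>"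
    using ex_subset_far_from_countable[OF cK] inf unfolding K_def by fastforce

  have "action_embeds (two_copy_action H A) \<alpha>"
    using univ in_class by (simp add: universal_action_def)
  then obtain \<phi> p q where \<phi>: "\<phi> \<in> hom H F" and pq: "p \<in> M" "q \<in> M"
    and orbit: "\<And>h. h \<in> K \<Longrightarrow> d p (action \<alpha> (\<phi> h) q) = (if h \<in> A then 2 else 1)"
    using two_copy_action_embeds_orbit[OF H] F unfolding F_def M_def d_def cH by metis
  obtain z w where zw: "z \<in> D" "w \<in> D" "d p z < 1/4" "d q w < 1/4"
    using dense pq by blast
  have "\<phi> \<in> hom (G\<lparr>carrier := K\<rparr>) F"
    using \<phi> by (simp add: hom_def H_def)
  then have "restrict \<phi> K \<in> \<Phi>" by (simp add: \<Phi>_def)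
  from A[OF this zw(1,2)] obtain h where h: "h \<in> K"
    and far: "1/2 \<le> \<bar>d z (action \<alpha> (\<phi> h) w) - (if h \<in> A then 2 else 1)\<bar>"
    by auto
  have "\<phi> h \<in> carrier F" using \<phi> h by (auto simp: hom_def)
  then have "\<bar>d p (action \<alpha> (\<phi> h) q) - d z (action \<alpha> (\<phi> h) w)\<bar> \<le> d p z + d q w"
    using isometric_action_dist_diff[OF iso\<alpha>] pq zw(1,2) D(2)
    unfolding F_def M_def d_def by blast
  then show False using far orbit[OF h] zw(3,4) by linarith
qed

end
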